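(* Let $\mathcal{M} \in \mathbb{R}^{I_1 \times \cdots \times I_N \times I_1 \times \cdots \times I_N}$ with spectral radius $\rho(\mathcal{M})<1$ (so that $\mathcal{I}-\mathcal{M}$ is invertible), let $\mathcal{B}\in\mathbb{R}^{I_1\times\cdots\times I_N}$, and let $\{\mathcal{X}_n\}_{n\ge 0}$ be a sequence in $\mathbb{R}^{I_1\times\cdots\times I_N}$ satisfying $\mathcal{X}_{n+1}=\mathcal{M} *_N \mathcal{X}_n+\mathcal{B}$ for all $n\ge 0$, with limit $\bar{\mathcal{X}}$. Put $\mathcal{D}_n=\mathcal{X}_{n+1}-\mathcal{X}_n$. Let $n\ge 0$ be such that $\mathcal{D}_n\neq\mathcal{O}$, and let $$\bar{\mathcal{P}}_{\mathcal{M}}^{[\mathcal{D}_n]}(x)=\sum_{i=0}^{d}\theta_i^{(n)}x^i,\qquad \theta_d^{(n)}=1,$$ be the minimal polynomial of $\mathcal{M}$ with respect to $\mathcal{D}_n$, where $d$ denotes its degree. Then $\sum_{i=0}^{d}\theta_i^{(n)}\neq 0$, and $$\bar{\mathcal{X}}=\frac{\sum_{i=0}^{d}\theta_i^{(n)}\,\mathcal{X}_{n+i}}{\sum_{i=0}^{d}\theta_i^{(n)}}.$$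
   Context: For $\mathcal{A}\in\mathbb{R}^{I_1\times\cdots\times I_N\times I_1\times\cdots\times I_N}$ the Einstein product with $\mathcal{X}\in\mathbb{R}^{I_1\times\cdots\times I_N}$ is $(\mathcal{A}*_N\mathcal{X})_{i_1\ldots i_N}=\sum_{j_1,\ldots,j_N}\mathcal{A}_{i_1\ldots i_N j_1\ldots j_N}\mathcal{X}_{j_1\ldots j_N}$, and with $\mathcal{B}\in\mathbb{R}^{I_1\times\cdots\times I_N\times I_1\times\cdots\times I_N}$ it is $(\mathcal{A}*_N\mathcal{B})_{i_1\ldots i_N k_1\ldots k_N}=\sum_{j_1,\ldots,j_N}\mathcal{A}_{i_1\ldots i_N j_1\ldots j_N}\mathcal{B}_{j_1\ldots j_N k_1\ldots k_N}$. The identity tensor $\mathcal{I}$ has entries $\prod_{k=1}^N\delta_{i_kj_k}$, and $\mathcal{O}$ denotes a zero tensor. $\mathcal{A}$ is invertible if there is $\mathcal{B}$ with $\mathcal{A}*_N\mathcal{B}=\mathcal{B}*_N\mathcal{A}=\mathcal{I}$. Powers are $\mathcal{A}^0=\mathcal{I}$, $\mathcal{A}^k=\mathcal{A}*_N\mathcal{A}^{k-1}$; for a polynomial $p(x)=\sum_k c_kx^k$, $p(\mathcal{A})=\sum_k c_k\mathcal{A}^k$. A scalar $\lambda$ (possibly complex) is an eigenvalue of $\mathcal{A}$ if $\mathcal{A}*_N\mathcal{X}=\lambda\mathcal{X}$ for some nonzero tensor $\mathcal{X}$ of size $I_1\times\cdots\times I_N$ (possibly complex); $\sigma(\mathcal{A})$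 is the set of eigenvalues and $\rho(\mathcal{A})=\max_{\lambda\in\sigma(\mathcal{A})}|\lambda|$. For a nonzero tensor $\mathcal{X}\in\mathbb{R}^{I_1\times\cdots\times I_N}$, the minimal polynomial $\bar{\mathcal{P}}_{\mathcal{A}}^{[\mathcal{X}]}$ of $\mathcal{A}$ with respect to $\mathcal{X}$ is the monic polynomial of smallest degree such that $\bar{\mathcal{P}}_{\mathcal{A}}^{[\mathcal{X}]}(\mathcal{A})*_N\mathcal{X}=\mathcal{O}$. *)

theory Defs
  imports
    "HOL-Analysis.Analysis"
    "HOL-Library.Function_Algebras"
    "HOL-Computational_Algebra.Polynomial"
begin

(* A shape I_1 x ... x I_N is the list [I_1, ..., I_N]. A multi-index is a list of natural numbers
   of the same length, with entries counted from 0. An entry of a tensor of shape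
   I_1 x ... x I_N x I_1 x ... x I_N is addressed by the concatenation i @ j of two multi-indices. *)

definition multi_indices :: "nat list \<Rightarrow> nat list set" where
  "multi_indices Is = {i. list_all2 (<) i Is}"

(* Tensors are total functions forced to be 0 off their index set, so that equality of functions
   is equality of tensors, the pointwise 0, +, - and sum of Function_Algebras are the tensor
   operations, and convergence in the product topology is convergence of tensors. *)

definition tensors :: "nat list \<Rightarrow> (nat list \<Rightarrow> 'a::zero) set" where
  "tensors Is = {T. \<forall>i. i \<notin> multi_indices Is \<longrightarrow> T i = 0}"

definition tscale :: "'a::comm_ring_1 \<Rightarrow> (nat list \<Rightarrow> 'a) \<Rightarrow> nat list \<Rightarrow> 'a" where
  "tscale c T = (\<lambda>i. c * T i)"

definition ein_vec ::
  "nat list \<Rightarrow> (nat list \<Rightarrow> 'a::comm_ring_1) \<Rightarrow> (nat list \<Rightarrow> 'a) \<Rightarrow> nat list \<Rightarrow> 'a" where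
  "ein_vec Is A X = (\<lambda>i. if i \<in> multi_indices Is
     then (\<Sum>j\<in>multi_indices Is. A (i @ j) * X j) else 0)"

(* l is i @ k, with i = take N l and k = drop N l for N = length Is; see ein_mult_append. *)

definition ein_mult ::
  "nat list \<Rightarrow> (nat list \<Rightarrow> 'a::comm_ring_1) \<Rightarrow> (nat list \<Rightarrow> 'a) \<Rightarrow> nat list \<Rightarrow> 'a" where
  "ein_mult Is A B = (\<lambda>l. if l \<in> multi_indices (Is @ Is)
     then (\<Sum>j\<in>multi_indices Is. A (take (length Is) l @ j) * B (j @ drop (length Is) l)) else 0)"

definition tident :: "nat list \<Rightarrow> nat list \<Rightarrow> 'a::comm_ring_1" where
  "tident Is = (\<lambda>l. if l \<in> multi_indices (Is @ Is)
     then (\<Prod>k<length Is. if l ! k = l ! (length Is + k) then 1 else 0) else 0)"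

definition tinvertible :: "nat list \<Rightarrow> (nat list \<Rightarrow> 'a::comm_ring_1) \<Rightarrow> bool" where
  "tinvertible Is A \<longleftrightarrow>
     (\<exists>B\<in>tensors (Is @ Is). ein_mult Is A B = tident Is \<and> ein_mult Is B A = tident Is)"

fun tpow :: "nat list \<Rightarrow> (nat list \<Rightarrow> 'a::comm_ring_1) \<Rightarrow> nat \<Rightarrow> nat list \<Rightarrow> 'a" where
  "tpow Is A 0 = tident Is"
| "tpow Is A (Suc k) = ein_mult Is A (tpow Is A k)"

definition tpoly :: "nat list \<Rightarrow> 'a::comm_ring_1 poly \<Rightarrow> (nat list \<Rightarrow> 'a) \<Rightarrow> nat list \<Rightarrow> 'a" where
  "tpoly Is p A = (\<Sum>k\<le>degree p. tscale (coeff p k) (tpow Is A k))"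

(* Eigenvalues of a real tensor are complex, with complex eigentensors. *)

definition teigenvalues :: "nat list \<Rightarrow> (nat list \<Rightarrow> real) \<Rightarrow> complex set" where
  "teigenvalues Is A =
     {c. \<exists>X\<in>tensors Is. X \<noteq> 0 \<and> ein_vec Is (\<lambda>l. complex_of_real (A l)) X = tscale c X}"

definition tspectral_radius :: "nat list \<Rightarrow> (nat list \<Rightarrow> real) \<Rightarrow> real" where
  "tspectral_radius Is A = Max (cmod ` teigenvalues Is A)"

definition tmin_poly ::
  "nat list \<Rightarrow> (nat list \<Rightarrow> real) \<Rightarrow> (nat list \<Rightarrow> real) \<Rightarrow> real poly" where
  "tmin_poly Is A X = (THE p. lead_coeff p = 1 \<and> ein_vec Is (tpoly Is p A) X = 0 \<and>
     (\<forall>q. lead_coeff q = 1 \<and> ein_vec Is (tpoly Is q A) X = 0 \<longrightarrow> degree p \<le> degree q))"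

lemma append_in_multi_indices:
  assumes "length i = length Is"
  shows "i @ k \<in> multi_indices (Is @ Ks) \<longleftrightarrow> i \<in> multi_indices Is \<and> k \<in> multi_indices Ks"
  using assms by (auto simp: multi_indices_def list_all2_append)

lemma ein_mult_append:
  assumes "i \<in> multi_indices Is" "k \<in> multi_indices Is"
  shows "ein_mult Is A B (i @ k) = (\<Sum>j\<in>multi_indices Is. A (i @ j) * B (j @ k))"
proof -
  have len: "length i = length Is"
    using assms by (auto simp: multi_indices_def dest: list_all2_lengthD)
  then show ?thesis
    using assms by (simp add: ein_mult_def append_in_multi_indices)
qed

lemma tident_append:
  assumes "i \<in> multi_indices Is" "j \<in> multi_indices Is"
  shows "tident Is (i @ j) = (if i = j then 1 else 0)"
proof -
  have len: "length i = length Is" "length j = length Is"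
    using assms by (auto simp: multi_indices_def dest: list_all2_lengthD)
  have "tident Is (i @ j) = (\<Prod>k<length Is. if i ! k = j ! k then 1 else 0)"
    using assms len by (auto simp: tident_def append_in_multi_indices nth_append intro!: prod.cong)
  also have "\<dots> = (if i = j then 1 else 0)"
  proof (cases "i = j")
    case False
    then obtain k where "k < length Is" "i ! k \<noteq> j ! k"
      using len by (metis nth_equalityI)
    then show ?thesis
      using False by (auto intro!: prod_zero bexI[of _ k])
  qed simp
  finally show ?thesis .
qed

end

theory Submission
  imports Defs
begin

text \<open>Some nonzero polynomial annihilates a tensor, so it has finitely many eigenvalues, and
  spectral radius below 1 makes \<open>I - M\<close> injective. Write \<open>q = (x - 1)^k * r\<close> with \<open>r(1) \<noteq> 0\<close> for a
  polynomial with \<open>q(M) = 0\<close>. Then \<open>r(M) = 0\<close>, and expanding \<open>r\<close> at 1 shows that the inverse of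
  \<open>I - M\<close> is a polynomial in \<open>M\<close>. Minimality and injectivity likewise exclude a factor \<open>x - 1\<close>
  of the minimal polynomial \<open>p\<close> of \<open>D\<^sub>n\<close>, so the coefficients of \<open>p\<close> have nonzero sum. The errors
  \<open>Y\<^sub>k = X\<^sub>k - Xbar\<close> satisfy \<open>Y\<^sub>k\<^sub>+\<^sub>1 = M Y\<^sub>k\<close> and \<open>D\<^sub>n = (M - I) Y\<^sub>n\<close>, so \<open>p(M) D\<^sub>n = 0\<close> gives
  \<open>p(M) Y\<^sub>n = 0\<close>, which is the claimed formula.\<close>

subsection \<open>Linear algebra of tensors\<close>

lemma finite_multi_indices [simp]: "finite (multi_indices Is)"
proof (induction Is)
  case Nil
  then show ?case by (simp add: multi_indices_def)
next
  case (Cons a Is)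
  have "multi_indices (a # Is) = (\<lambda>(x, xs). x # xs) ` ({..<a} \<times> multi_indices Is)"
    by (auto simp: multi_indices_def list_all2_Cons2)
  then show ?case using Cons by simp
qed

lemma sum_fun_apply: "(\<Sum>k\<in>S. f k) x = (\<Sum>k\<in>S. f k x :: 'b :: comm_monoid_add)"
  by (induction S rule: infinite_finite_induct) auto

lemma tensors_0 [simp]: "0 \<in> tensors Is"
  by (simp add: tensors_def)

lemma tensors_add: "S \<in> tensors Is \<Longrightarrow> T \<in> tensors Is \<Longrightarrow> S + T \<in> tensors Is"
  for S T :: "nat list \<Rightarrow> 'a :: comm_ring_1"
  by (simp add: tensors_def)

lemma tensors_diff: "S \<in> tensors Is \<Longrightarrow> T \<in> tensors Is \<Longrightarrow> S - T \<in> tensors Is"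
  for S T :: "nat list \<Rightarrow> 'a :: comm_ring_1"
  by (simp add: tensors_def)

lemma tensors_tscale: "T \<in> tensors Is \<Longrightarrow> tscale c T \<in> tensors Is"
  by (simp add: tensors_def tscale_def)

lemma tensors_sum: "(\<And>k. k \<in> S \<Longrightarrow> f k \<in> tensors Is) \<Longrightarrow> (\<Sum>k\<in>S. f k) \<in> tensors Is"
  for f :: "'b \<Rightarrow> nat list \<Rightarrow> 'a :: comm_ring_1"
  by (induction S rule: infinite_finite_induct) (auto intro: tensors_add)

lemma ein_vec_tensors [simp]: "ein_vec Is A X \<in> tensors Is"
  by (simp add: tensors_def ein_vec_def)

lemma ein_mult_tensors [simp]: "ein_mult Is A B \<in> tensors (Is @ Is)"
  by (simp add: tensors_def ein_mult_def)

lemma tident_tensors [simp]: "tident Is \<in> tensors (Is @ Is)"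
  by (simp add: tensors_def tident_def)

lemma tpow_tensors [simp]: "tpow Is A k \<in> tensors (Is @ Is)"
  by (cases k) auto

lemma tpoly_tensors [simp]: "tpoly Is p A \<in> tensors (Is @ Is)"
  unfolding tpoly_def by (intro tensors_sum tensors_tscale tpow_tensors)

lemma ein_vec_zero [simp]: "ein_vec Is A 0 = 0"
  by (simp add: ein_vec_def fun_eq_iff)

lemma ein_vec_add: "ein_vec Is A (X + Y) = ein_vec Is A X + ein_vec Is A Y"
  by (auto simp: ein_vec_def fun_eq_iff distrib_left sum.distrib)

lemma ein_vec_diff: "ein_vec Is A (X - Y) = ein_vec Is A X - ein_vec Is A Y"
  by (auto simp: ein_vec_def fun_eq_iff right_diff_distrib sum_subtractf)

lemma ein_vec_tscale: "ein_vec Is A (tscale c X) = tscale c (ein_vec Is A X)"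
  by (auto simp: ein_vec_def tscale_def fun_eq_iff sum_distrib_left mult_ac)

lemma ein_vec_diff_left: "ein_vec Is (A - B) X = ein_vec Is A X - ein_vec Is B X"
  by (auto simp: ein_vec_def fun_eq_iff left_diff_distrib sum_subtractf)

lemma ein_vec_add_left: "ein_vec Is (A + B) X = ein_vec Is A X + ein_vec Is B X"
  by (auto simp: ein_vec_def fun_eq_iff distrib_right sum.distrib)

lemma ein_vec_tscale_left: "ein_vec Is (tscale c A) X = tscale c (ein_vec Is A X)"
  by (auto simp: ein_vec_def tscale_def fun_eq_iff sum_distrib_left mult_ac)

lemma ein_vec_zero_left [simp]: "ein_vec Is 0 X = 0"
  by (auto simp: ein_vec_def fun_eq_iff)

text \<open>Induction leaves eta-expanded goals, in which the pointwise rules for \<open>+\<close> and \<open>0\<close> would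
  unfold the tensor operations under a \<open>\<lambda>\<close>. Hence these rules are removed below.\<close>

lemma ein_vec_sum_left: "ein_vec Is (\<Sum>k\<in>S. f k) X = (\<Sum>k\<in>S. ein_vec Is (f k) X)"
  by (induction S rule: infinite_finite_induct)
     (simp_all add: ein_vec_add_left del: plus_fun_apply zero_fun_apply)

lemma ein_vec_tident: "X \<in> tensors Is \<Longrightarrow> ein_vec Is (tident Is) X = X"
  by (auto simp: ein_vec_def fun_eq_iff tensors_def tident_append if_distrib[of "\<lambda>x. x * _"]
      cong: if_cong)

text \<open>Exchanging two finite sums gives this; products of tensors can then be treated as
  compositions of operators.\<close>

lemma ein_vec_ein_mult: "ein_vec Is (ein_mult Is A B) X = ein_vec Is A (ein_vec Is B X)"
proof
  fix i
  show "ein_vec Is (ein_mult Is A B) X i = ein_vec Is A (ein_vec Is B X) i"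
  proof (cases "i \<in> multi_indices Is")
    case True
    have "ein_vec Is (ein_mult Is A B) X i =
      (\<Sum>k\<in>multi_indices Is. \<Sum>j\<in>multi_indices Is. A (i @ j) * B (j @ k) * X k)"
      using True by (simp add: ein_vec_def ein_mult_append sum_distrib_right)
    also have "\<dots> = (\<Sum>j\<in>multi_indices Is. \<Sum>k\<in>multi_indices Is. A (i @ j) * B (j @ k) * X k)"
      by (rule sum.swap)
    also have "\<dots> = ein_vec Is A (ein_vec Is B X) i"
      using True by (simp add: ein_vec_def sum_distrib_left mult.assoc)
    finally show ?thesis .
  qed (simp add: ein_vec_def)
qed

lemma multi_indices_append_cases:
  assumes "l \<in> multi_indices (Is @ Js)"
  obtains i j where "l = i @ j" "i \<in> multi_indices Is" "j \<in> multi_indices Js"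
  using assms by (auto simp: multi_indices_def list_all2_append2)

text \<open>The entry at \<open>i @ j\<close> is recovered by applying the tensor to the unit tensor
  at \<open>j\<close> and reading off position \<open>i\<close>. Identities between products thus
  reduce to identities between operators.\<close>

lemma tensor_eqI:
  fixes A B :: "nat list \<Rightarrow> 'a :: comm_ring_1"
  assumes A: "A \<in> tensors (Is @ Is)" and B: "B \<in> tensors (Is @ Is)"
    and eq: "\<And>X. X \<in> tensors Is \<Longrightarrow> ein_vec Is A X = ein_vec Is B X"
  shows "A = B"
proof
  fix l
  show "A l = B l"
  proof (cases "l \<in> multi_indices (Is @ Is)")
    case True
    then obtain i j where l: "l = i @ j" "i \<in> multi_indices Is" "j \<in> multi_indices Is"
      by (rule multi_indices_append_cases)
    define U :: "nat list \<Rightarrow> 'a" where "U = (\<lambda>k. if k = j then 1 else 0)"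
    have "U \<in> tensors Is"
      using l by (auto simp: U_def tensors_def)
    then have "ein_vec Is A U i = ein_vec Is B U i"
      using eq by simp
    then show ?thesis
      using l by (simp add: ein_vec_def U_def if_distrib[of "\<lambda>x. _ * x"] cong: if_cong)
  next
    case False
    then show ?thesis using A B by (simp add: tensors_def)
  qed
qed

section \<open>Linear dependence and annihilating polynomials\<close>

interpretation tensor: vector_space "tscale :: 'a::field \<Rightarrow> _"
  by unfold_locales (auto simp: tscale_def fun_eq_iff algebra_simps)

text \<open>A dimension count: the \<open>N + 1\<close> tensors \<open>v 0\<close>, ...,
  \<open>v N\<close> lie in a space spanned by \<open>N\<close> unit tensors. The coefficients of
  the resulting relation are packed into a polynomial.\<close>

lemma exists_poly_relation:
  fixes v :: "nat \<Rightarrow> nat list \<Rightarrow> 'a :: field"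
  assumes v: "\<And>k. v k \<in> tensors Is"
  shows "\<exists>p. p \<noteq> 0 \<and> (\<Sum>k\<le>degree p. tscale (coeff p k) (v k)) = 0"
proof -
  define N where "N = card (multi_indices Is)"
  have "\<exists>c. (\<exists>k\<le>N. c k \<noteq> 0) \<and> (\<Sum>k\<le>N. tscale (c k) (v k)) = 0"
  \<comment> \<open>Dependence is a property of sets, and a repeated value makes the image of
    \<open>{..N}\<close> smaller. In that case the difference of two equal terms is already a
    relation.\<close>
  proof (cases "inj_on v {..N}")
    case False
    then obtain a b where ab: "a \<le> N" "b \<le> N" "a \<noteq> b" "v a = v b"
      by (auto simp: inj_on_def)
    define c :: "nat \<Rightarrow> 'a" where "c = (\<lambda>k. (if k = a then 1 else 0) - (if k = b then 1 else 0))"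
    have "(\<Sum>k\<le>N. tscale (c k) (v k)) = 0"
      using ab by (auto simp: fun_eq_iff sum_fun_apply tscale_def c_def left_diff_distrib
          sum_subtractf if_distrib[of "\<lambda>x. x * _"] cong: if_cong)
    moreover have "c a \<noteq> 0" using ab by (simp add: c_def)
    ultimately show ?thesis using ab by blast
  next
    case True
    \<comment> \<open>The vector space consists of all functions on lists; the shape enters only
      through the span of these unit tensors.\<close>
    define e :: "nat list \<Rightarrow> nat list \<Rightarrow> 'a" where "e = (\<lambda>j i. if i = j then 1 else 0)"
    have span: "T \<in> tensor.span (e ` multi_indices Is)" if "T \<in> tensors Is" for T
    proof -
      have "T = (\<Sum>j\<in>multi_indices Is. tscale (T j) (e j))"
        using that by (auto simp: fun_eq_iff sum_fun_apply tscale_def e_def tensors_def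
            if_distrib[of "\<lambda>x. _ * x"] cong: if_cong)
      also have "\<dots> \<in> tensor.span (e ` multi_indices Is)"
        by (intro tensor.span_sum tensor.span_scale tensor.span_base) auto
      finally show ?thesis .
    qed
    have "tensor.dependent (v ` {..N})"
    proof (rule ccontr)
      assume "tensor.independent (v ` {..N})"
      then have "card (v ` {..N}) \<le> card (e ` multi_indices Is)"
        using tensor.independent_span_bound[of "e ` multi_indices Is" "v ` {..N}"] span v by auto
      also have "\<dots> \<le> N" by (simp add: N_def card_image_le)
      finally show False using True by (simp add: card_image)
    qed
    then obtain u k where "k \<le> N" "u (v k) \<noteq> 0" "(\<Sum>w\<in>v ` {..N}. tscale (u w) w) = 0"
      by (auto simp: tensor.dependent_finite)
    then show ?thesis
      using True by (intro exI[of _ "\<lambda>k. u (v k)"]) (auto simp: sum.reindex)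
  qed
  then obtain c k where c: "k \<le> N" "c k \<noteq> 0" "(\<Sum>k\<le>N. tscale (c k) (v k)) = 0"
    by blast
  define p where "p = (\<Sum>k\<le>N. monom (c k) k)"
  have coeff: "coeff p k = (if k \<le> N then c k else 0)" for k
    by (simp add: p_def coeff_sum)
  have "p \<noteq> 0" using c coeff by (metis coeff_0)
  moreover have "degree p \<le> N" by (rule degree_le) (simp add: coeff)
  then have "(\<Sum>k\<le>degree p. tscale (coeff p k) (v k)) = (\<Sum>k\<le>N. tscale (coeff p k) (v k))"
    by (intro sum.mono_neutral_left) (auto simp: coeff_eq_0)
  then have "(\<Sum>k\<le>degree p. tscale (coeff p k) (v k)) = 0"
    using c by (simp add: coeff)
  ultimately show ?thesis by blast
qed

lemma exists_annihilating_poly: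
  fixes A :: "nat list \<Rightarrow> 'a :: field"
  shows "\<exists>p. p \<noteq> 0 \<and> tpoly Is p A = 0"
  unfolding tpoly_def by (rule exists_poly_relation) (rule tpow_tensors)

subsection \<open>Polynomials in a tensor acting on tensors\<close>

lemma ein_vec_tpow: "X \<in> tensors Is \<Longrightarrow> ein_vec Is (tpow Is A k) X = (ein_vec Is A ^^ k) X"
  by (induction k) (auto simp: ein_vec_tident ein_vec_ein_mult)

lemma ein_vec_tpoly:
  assumes "X \<in> tensors Is"
  shows "ein_vec Is (tpoly Is p A) X = (\<Sum>k\<le>degree p. tscale (coeff p k) ((ein_vec Is A ^^ k) X))"
  using assms by (simp add: tpoly_def ein_vec_sum_left ein_vec_tscale_left ein_vec_tpow)

lemma ein_vec_sum: "ein_vec Is A (\<Sum>k\<in>S. f k) = (\<Sum>k\<in>S. ein_vec Is A (f k))"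
  by (induction S rule: infinite_finite_induct)
     (simp_all add: ein_vec_add del: plus_fun_apply zero_fun_apply)

lemma tpoly_0 [simp]: "tpoly Is 0 A = 0"
  by (simp add: tpoly_def tscale_def fun_eq_iff)

text \<open>Horner's rule, the recursion behind the inductions on polynomials that follow.\<close>

lemma ein_vec_tpoly_pCons:
  assumes X: "X \<in> tensors Is"
  shows "ein_vec Is (tpoly Is (pCons a p) A) X =
    tscale a X + ein_vec Is A (ein_vec Is (tpoly Is p A) X)"
proof -
  let ?s = "\<lambda>q k. tscale (coeff q k) ((ein_vec Is A ^^ k) X)"
  have "ein_vec Is (tpoly Is (pCons a p) A) X = (\<Sum>k\<le>degree (pCons a p). ?s (pCons a p) k)"
    by (rule ein_vec_tpoly[OF X])
  \<comment> \<open>For \<open>p = 0\<close> the degree of \<open>pCons a p\<close> is 0 and not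
    \<open>Suc (degree p)\<close>, so the sum is padded with zero terms.\<close>
  also have "\<dots> = (\<Sum>k\<le>Suc (degree p). ?s (pCons a p) k)"
    by (intro sum.mono_neutral_left)
       (use degree_pCons_le[of a p] in \<open>auto simp: coeff_eq_0 tscale_def fun_eq_iff\<close>)
  also have "\<dots> = tscale a X + (\<Sum>k\<le>degree p. ein_vec Is A (?s p k))"
    by (simp only: sum.atMost_Suc_shift) (simp add: ein_vec_tscale)
  also have "\<dots> = tscale a X + ein_vec Is A (ein_vec Is (tpoly Is p A) X)"
    by (simp add: ein_vec_tpoly[OF X] ein_vec_sum)
  finally show ?thesis .
qed

lemma tscale_simps [simp]:
  "tscale 0 X = 0" "tscale 1 X = X" "tscale c 0 = 0"
  by (simp_all add: tscale_def fun_eq_iff)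

lemma tscale_algebra:
  "tscale (a + b) X = tscale a X + tscale b X" "tscale (a - b) X = tscale a X - tscale b X"
  "tscale c (X + Y) = tscale c X + tscale c Y" "tscale c (X - Y) = tscale c X - tscale c Y"
  "tscale (a * b) X = tscale a (tscale b X)"
  by (simp_all add: tscale_def fun_eq_iff algebra_simps)

lemma ein_vec_tpoly_add:
  assumes X: "X \<in> tensors Is"
  shows "ein_vec Is (tpoly Is (p + q) A) X =
    ein_vec Is (tpoly Is p A) X + ein_vec Is (tpoly Is q A) X"
  by (induction p q rule: poly_induct2)
     (simp_all add: ein_vec_tpoly_pCons[OF X] tscale_algebra ein_vec_add add_ac
       del: plus_fun_apply zero_fun_apply)

lemma ein_vec_tpoly_smult:
  assumes X: "X \<in> tensors Is"
  shows "ein_vec Is (tpoly Is (smult c p) A) X = tscale c (ein_vec Is (tpoly Is p A) X)"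
  by (induction p)
     (simp_all add: ein_vec_tpoly_pCons[OF X] tscale_algebra ein_vec_tscale
       del: plus_fun_apply zero_fun_apply)

text \<open>Since multiplication of polynomials is commutative, this also shows that any two
  polynomials in \<open>A\<close> commute as operators.\<close>

lemma ein_vec_tpoly_mult:
  assumes X: "X \<in> tensors Is"
  shows "ein_vec Is (tpoly Is (p * q) A) X = ein_vec Is (tpoly Is p A) (ein_vec Is (tpoly Is q A) X)"
  by (induction p)
     (simp_all add: ein_vec_tpoly_pCons[OF X] ein_vec_tpoly_pCons[OF ein_vec_tensors]
       ein_vec_tpoly_add[OF X] ein_vec_tpoly_smult[OF X]
       del: plus_fun_apply zero_fun_apply)

lemma ein_vec_tpoly_linear:
  assumes X: "X \<in> tensors Is"
  shows "ein_vec Is (tpoly Is [:a, b:] A) X = tscale a X + tscale b (ein_vec Is A X)"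
  by (simp add: ein_vec_tpoly_pCons[OF X] ein_vec_tscale)

lemma ein_vec_tpoly_eigen:
  assumes X: "X \<in> tensors Is" and eigen: "ein_vec Is A X = tscale c X"
  shows "ein_vec Is (tpoly Is p A) X = tscale (poly p c) X"
  by (induction p)
     (simp_all add: ein_vec_tpoly_pCons[OF X] ein_vec_tscale eigen tscale_algebra(1)
       tscale_algebra(5)[symmetric] mult.commute
       del: plus_fun_apply zero_fun_apply)

subsection \<open>Spectral radius and minimal polynomial\<close>

text \<open>Every eigenvalue is a root of any polynomial that annihilates the tensor. Finiteness is
  what makes the \<open>Max\<close> in the spectral radius an upper bound.\<close>

lemma finite_teigenvalues: "finite (teigenvalues Is A)"
proof -
  let ?A = "\<lambda>l. complex_of_real (A l)"
  obtain p where p: "p \<noteq> 0" "tpoly Is p ?A = 0"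
    using exists_annihilating_poly by blast
  have "teigenvalues Is A \<subseteq> {c. poly p c = 0}"
  proof
    fix c assume "c \<in> teigenvalues Is A"
    then obtain X where X: "X \<in> tensors Is" "X \<noteq> 0" "ein_vec Is ?A X = tscale c X"
      by (auto simp: teigenvalues_def)
    have "tscale (poly p c) X = 0"
      using ein_vec_tpoly_eigen[OF X(1,3), of p] p by simp
    then show "c \<in> {c. poly p c = 0}" using X by simp
  qed
  then show ?thesis using poly_roots_finite[OF p(1)] finite_subset by blast
qed

text \<open>A nonzero fixed tensor, read as a complex one, would be an eigentensor for the
  eigenvalue 1 and force the spectral radius to be at least 1.\<close>

lemma no_fixed_tensor:
  assumes rho: "tspectral_radius Is M < 1" and X: "X \<in> tensors Is" and fixed: "ein_vec Is M X = X"
  shows "X = 0"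
proof (rule ccontr)
  assume "X \<noteq> 0"
  let ?X = "\<lambda>i. complex_of_real (X i)"
  have "ein_vec Is (\<lambda>l. complex_of_real (M l)) ?X i = complex_of_real (ein_vec Is M X i)" for i
    by (simp add: ein_vec_def)
  then have "ein_vec Is (\<lambda>l. complex_of_real (M l)) ?X = tscale 1 ?X"
    using fixed by (simp add: fun_eq_iff)
  moreover have "?X \<in> tensors Is" "?X \<noteq> 0"
    using X \<open>X \<noteq> 0\<close> by (auto simp: tensors_def fun_eq_iff)
  ultimately have "1 \<in> teigenvalues Is M"
    unfolding teigenvalues_def by blast
  then have "cmod 1 \<le> Max (cmod ` teigenvalues Is M)"
    by (intro Max_ge finite_imageI finite_teigenvalues imageI)
  then show False using rho by (simp add: tspectral_radius_def)
qed

text \<open>The assumption \<open>inj\<close> says that \<open>A - I\<close> has trivial kernel, so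
  the factors \<open>x - 1\<close> can be stripped one at a time.\<close>

lemma ein_vec_tpoly_minus_one_power_eq_0:
  assumes inj: "\<And>X. X \<in> tensors Is \<Longrightarrow> ein_vec Is A X = X \<Longrightarrow> X = 0"
    and X: "X \<in> tensors Is" and eq: "ein_vec Is (tpoly Is ([:-1, 1:] ^ k) A) X = 0"
  shows "X = 0"
  using eq
proof (induction k)
  case 0
  then show ?case
    using X by (simp add: one_pCons ein_vec_tpoly_pCons[OF X] del: pCons_one)
next
  case (Suc k)
  let ?Y = "ein_vec Is (tpoly Is ([:-1, 1:] ^ k) A) X"
  have "tscale (-1) ?Y + ein_vec Is A ?Y = 0"
    using Suc.prems by (simp only: power_Suc ein_vec_tpoly_mult[OF X]
        ein_vec_tpoly_linear[OF ein_vec_tensors] tscale_simps)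
  then have "ein_vec Is A ?Y = ?Y"
    by (simp add: fun_eq_iff tscale_def)
  then show ?case using Suc.IH inj[OF ein_vec_tensors] by blast
qed

text \<open>If \<open>r\<close> annihilates \<open>A\<close> and \<open>r(1)\<close> is nonzero,
  then \<open>1 - x\<close> is a unit modulo \<open>r\<close>, and its inverse \<open>t\<close>
  modulo \<open>r\<close> yields the inverse \<open>t(A)\<close> of \<open>I - A\<close>.\<close>

lemma tinvertible_ident_minus:
  fixes A :: "nat list \<Rightarrow> 'a :: field"
  assumes inj: "\<And>X. X \<in> tensors Is \<Longrightarrow> ein_vec Is A X = X \<Longrightarrow> X = 0"
  shows "tinvertible Is (tident Is - A)"
proof -
  obtain q where q: "q \<noteq> 0" "tpoly Is q A = 0"
    using exists_annihilating_poly by blast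
  obtain r where r: "q = [:-1, 1:] ^ order 1 q * r" "\<not> [:-1, 1:] dvd r"
    using order_decomp[OF q(1), of 1] by auto
  have r1: "poly r 1 \<noteq> 0" using r(2) by (simp add: poly_eq_0_iff_dvd)
  have rX: "ein_vec Is (tpoly Is r A) X = 0" if X: "X \<in> tensors Is" for X
    using ein_vec_tpoly_minus_one_power_eq_0[OF inj ein_vec_tensors]
      ein_vec_tpoly_mult[OF X, of "[:-1, 1:] ^ order 1 q" r A] q(2) r(1) by simp
  \<comment> \<open>The remainder of \<open>r\<close> on division by \<open>x - 1\<close> is
    \<open>r(1)\<close>; scaling the quotient by \<open>1 / r(1)\<close> gives
    \<open>t\<close>.\<close>
  have "[:-1, 1:] dvd r - [:poly r 1:]"
    by (simp add: poly_eq_0_iff_dvd[symmetric])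
  then obtain s where s: "r - [:poly r 1:] = [:-1, 1:] * s" by (elim dvdE)
  define t where "t = smult (1 / poly r 1) s"
  have t: "[:1, -1:] * t = 1 + smult (- 1 / poly r 1) r"
  proof -
    have neg: "[:1, -1:] = smult (-1) [:-1, 1::'a:]" by simp
    have "[:1, -1:] * t = smult (- 1 / poly r 1) ([:-1, 1:] * s)"
      by (simp only: neg t_def mult_smult_left mult_smult_right smult_smult) simp
    also have "\<dots> = 1 + smult (- 1 / poly r 1) r"
      using r1 by (simp only: s[symmetric]) (simp add: smult_diff_right one_pCons)
    finally show ?thesis .
  qed
  have I: "ein_vec Is (tpoly Is ([:1, -1:] * t) A) X = X" if X: "X \<in> tensors Is" for X
    unfolding t ein_vec_tpoly_add[OF X] ein_vec_tpoly_smult[OF X] rX[OF X]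
    using X by (simp add: one_pCons ein_vec_tpoly_pCons[OF X] del: pCons_one)
  have L: "ein_vec Is (tident Is - A) X = ein_vec Is (tpoly Is [:1, -1:] A) X"
    if X: "X \<in> tensors Is" for X
    by (simp add: ein_vec_diff_left ein_vec_tident X ein_vec_tpoly_linear tscale_def fun_eq_iff)
  let ?T = "tpoly Is t A"
  have "ein_mult Is (tident Is - A) ?T = tident Is"
  proof (rule tensor_eqI)
    fix X :: "nat list \<Rightarrow> 'a" assume X: "X \<in> tensors Is"
    show "ein_vec Is (ein_mult Is (tident Is - A) ?T) X = ein_vec Is (tident Is) X"
      using I[OF X] by (simp only: ein_vec_ein_mult L[OF ein_vec_tensors] ein_vec_tident[OF X]
          ein_vec_tpoly_mult[OF X])
  qed auto
  \<comment> \<open>The other side follows because the factors commute as polynomials.\<close>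
  moreover have "ein_mult Is ?T (tident Is - A) = tident Is"
  proof (rule tensor_eqI)
    fix X :: "nat list \<Rightarrow> 'a" assume X: "X \<in> tensors Is"
    show "ein_vec Is (ein_mult Is ?T (tident Is - A)) X = ein_vec Is (tident Is) X"
      using I[OF X] by (simp only: ein_vec_ein_mult L[OF X] ein_vec_tident[OF X]
          ein_vec_tpoly_mult[OF X, symmetric] mult.commute)
  qed auto
  ultimately show ?thesis
    unfolding tinvertible_def using tpoly_tensors by blast
qed

text \<open>The description \<open>THE\<close> must be shown to denote. A nonzero annihilator of
  \<open>A\<close> scaled to be monic gives existence, and a least degree can be chosen; the
  difference of two minimal candidates would be an annihilator of smaller degree.\<close>

lemma tmin_poly_props:
  fixes A :: "nat list \<Rightarrow> real"
  assumes X: "X \<in> tensors Is"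
  defines "p \<equiv> tmin_poly Is A X"
  shows "lead_coeff p = 1" and "ein_vec Is (tpoly Is p A) X = 0"
    and "\<And>q. lead_coeff q = 1 \<Longrightarrow> ein_vec Is (tpoly Is q A) X = 0 \<Longrightarrow> degree p \<le> degree q"
proof -
  let ?ann = "\<lambda>q. lead_coeff q = 1 \<and> ein_vec Is (tpoly Is q A) X = 0"
  have monic: "?ann (smult (1 / lead_coeff q) q)"
    if "q \<noteq> 0" "ein_vec Is (tpoly Is q A) X = 0" for q
    using that by (simp add: ein_vec_tpoly_smult[OF X])
  obtain q where "q \<noteq> 0" "tpoly Is q A = 0"
    using exists_annihilating_poly by blast
  then have "?ann (smult (1 / lead_coeff q) q)" using monic by simp
  then obtain m where m: "?ann m" "\<And>q. ?ann q \<Longrightarrow> degree m \<le> degree q"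
    using ex_has_least_nat[of ?ann _ degree] by blast
  have unique: "m' = m" if m': "?ann m'" "\<And>q. ?ann q \<Longrightarrow> degree m' \<le> degree q" for m'
  proof (rule ccontr)
    assume ne: "m' \<noteq> m"
    have deg: "degree m' = degree m" using m m' by (meson antisym)
    define r where "r = m' + smult (-1) m"
    have r: "r \<noteq> 0" "ein_vec Is (tpoly Is r A) X = 0"
      unfolding r_def ein_vec_tpoly_add[OF X] ein_vec_tpoly_smult[OF X] using ne m(1) m'(1) by auto
    then have "degree m \<le> degree r" using m(2)[OF monic[OF r]] by simp
    \<comment> \<open>The two bounds give \<open>r\<close> the degree of \<open>m\<close>, but the
      leading terms cancel at exactly that degree.\<close>
    moreover have "degree r \<le> degree m" using deg by (simp add: r_def degree_diff_le)
    moreover have "coeff r (degree m) = 0" using m(1) m'(1) deg by (simp add: r_def)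
    ultimately show False using r(1) by (metis antisym leading_coeff_0_iff)
  qed
  have "?ann p \<and> (\<forall>q. ?ann q \<longrightarrow> degree p \<le> degree q)"
    unfolding p_def tmin_poly_def
    using theI[of "\<lambda>p. lead_coeff p = 1 \<and> ein_vec Is (tpoly Is p A) X = 0 \<and>
     (\<forall>q. lead_coeff q = 1 \<and> ein_vec Is (tpoly Is q A) X = 0 \<longrightarrow> degree p \<le> degree q)" m]
      m unique by blast
  then show "lead_coeff p = 1" and "ein_vec Is (tpoly Is p A) X = 0"
    and "\<And>q. lead_coeff q = 1 \<Longrightarrow> ein_vec Is (tpoly Is q A) X = 0 \<Longrightarrow> degree p \<le> degree q"
    by blast+
qed

text \<open>If 1 were a root, injectivity of \<open>A - I\<close> would let the factor
  \<open>x - 1\<close> be cancelled, leaving a monic annihilator of \<open>X\<close> of degree one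
  less.\<close>

lemma poly_tmin_poly_1_nonzero:
  fixes A :: "nat list \<Rightarrow> real"
  assumes inj: "\<And>Y. Y \<in> tensors Is \<Longrightarrow> ein_vec Is A Y = Y \<Longrightarrow> Y = 0" and X: "X \<in> tensors Is"
  shows "poly (tmin_poly Is A X) 1 \<noteq> 0"
proof
  let ?p = "tmin_poly Is A X"
  note p = tmin_poly_props[OF X, where A = A]
  assume "poly ?p 1 = 0"
  then obtain r where r: "?p = [:-1, 1:] * r"
    by (auto simp: poly_eq_0_iff_dvd elim: dvdE)
  have "r \<noteq> 0" using p(1) r by auto
  then have deg: "degree ?p = Suc (degree r)"
    unfolding r by (subst degree_mult_eq) auto
  have "lead_coeff r = 1" using p(1) unfolding r lead_coeff_mult by simp
  moreover have "ein_vec Is (tpoly Is r A) X = 0"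
    using ein_vec_tpoly_minus_one_power_eq_0[OF inj ein_vec_tensors, where k = 1] p(2)
      ein_vec_tpoly_mult[OF X, of "[:-1, 1:]" r A] r by simp
  ultimately have "degree ?p \<le> degree r" by (rule p(3))
  then show False using deg by simp
qed

section \<open>The formula for the limit\<close>

theorem theorem4:
  fixes Is :: "nat list"
    and M B Xbar :: "nat list \<Rightarrow> real"
    and X D :: "nat \<Rightarrow> nat list \<Rightarrow> real"
    and n d :: nat
    and \<theta> :: "nat \<Rightarrow> real"
  assumes "Is \<noteq> []" and "\<forall>m\<in>set Is. m \<ge> 1"
    and "M \<in> tensors (Is @ Is)"
    and "tspectral_radius Is M < 1"
    and "B \<in> tensors Is"
    and "\<And>k. X k \<in> tensors Is"
    and "\<And>k. X (Suc k) = ein_vec Is M (X k) + B"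
    and "Xbar \<in> tensors Is"
    and "X \<longlonglongrightarrow> Xbar"
    and "\<And>k. D k = X (Suc k) - X k"
    and "D n \<noteq> 0"
    and "d = degree (tmin_poly Is M (D n))"
    and "\<And>i. \<theta> i = coeff (tmin_poly Is M (D n)) i"
  shows "tinvertible Is (tident Is - M)
    \<and> (\<Sum>i\<le>d. \<theta> i) \<noteq> 0
    \<and> Xbar = tscale (1 / (\<Sum>i\<le>d. \<theta> i)) (\<Sum>i\<le>d. tscale (\<theta> i) (X (n + i)))"
proof -
  let ?E = "ein_vec Is M" and ?p = "tmin_poly Is M (D n)"
  have inj: "Y = 0" if "Y \<in> tensors Is" "?E Y = Y" for Y
    using no_fixed_tensor assms(4) that by blast
  \<comment> \<open>Each entry of the recurrence is a finite sum, so it passes to the limit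
    entrywise.\<close>
  have fixpoint: "Xbar = ?E Xbar + B"
  proof
    fix i
    have lim: "(\<lambda>k. X k j) \<longlonglongrightarrow> Xbar j" for j
      using continuous_on_tendsto_compose[OF continuous_on_product_coordinates assms(9)] by simp
    have "(\<lambda>k. ?E (X k) i + B i) \<longlonglongrightarrow> ?E Xbar i + B i"
      unfolding ein_vec_def by (cases "i \<in> multi_indices Is") (auto intro!: tendsto_intros lim)
    moreover have "(\<lambda>k. ?E (X k) i + B i) \<longlonglongrightarrow> Xbar i"
      using LIMSEQ_Suc[OF lim[of i]] by (simp add: assms(7))
    ultimately show "Xbar i = (?E Xbar + B) i"
      using LIMSEQ_unique by fastforce
  qed
  define Y where "Y k = X k - Xbar" for k
  have Y: "Y k \<in> tensors Is" for k
    unfolding Y_def by (intro tensors_diff assms(6,8))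
  have Y_Suc: "Y (Suc k) = ?E (Y k)" for k
    unfolding Y_def assms(7) ein_vec_diff by (subst fixpoint) (simp add: algebra_simps)
  have Y_add: "(?E ^^ i) (Y k) = Y (k + i)" for i k
    by (induction i) (simp_all add: Y_Suc)
  have D: "D n \<in> tensors Is"
    unfolding assms(10) by (intro tensors_diff assms(6))
  have "D n = Y (Suc n) - Y n" by (simp add: assms(10) Y_def)
  then have D_eq: "D n = ein_vec Is (tpoly Is [:-1, 1:] M) (Y n)"
    by (simp add: ein_vec_tpoly_linear[OF Y] Y_Suc tscale_def fun_eq_iff)
  \<comment> \<open>Commuting the two polynomials turns the left-hand side into \<open>p(M)\<close>
    applied to \<open>D n\<close>, where \<open>p\<close> is the minimal polynomial; this is
    zero.\<close>
  have "ein_vec Is (tpoly Is [:-1, 1:] M) (ein_vec Is (tpoly Is ?p M) (Y n)) = 0"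
    using tmin_poly_props(2)[OF D, where A = M]
    by (simp only: ein_vec_tpoly_mult[OF Y, symmetric] mult.commute[of _ ?p])
       (simp only: ein_vec_tpoly_mult[OF Y] D_eq[symmetric])
  \<comment> \<open>Injectivity of \<open>M - I\<close> transfers the annihilation from the
    computable difference \<open>D n\<close> to the unknown error \<open>Y n\<close>.\<close>
  then have "ein_vec Is (tpoly Is ?p M) (Y n) = 0"
    using ein_vec_tpoly_minus_one_power_eq_0[OF inj ein_vec_tensors, where k = 1] by simp
  then have "(\<Sum>i\<le>d. tscale (\<theta> i) (Y (n + i))) = 0"
    by (simp add: ein_vec_tpoly[OF Y] Y_add assms(12,13))
  then have "(\<Sum>i\<le>d. \<theta> i * (X (n + i) l - Xbar l)) = 0" for l
    by (auto simp: Y_def fun_eq_iff sum_fun_apply tscale_def)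
  then have sum: "(\<Sum>i\<le>d. \<theta> i * X (n + i) l) = (\<Sum>i\<le>d. \<theta> i) * Xbar l" for l
    by (simp add: right_diff_distrib sum_subtractf sum_distrib_right)
  \<comment> \<open>The sum of the coefficients is the value of the minimal polynomial at 1.\<close>
  have nz: "(\<Sum>i\<le>d. \<theta> i) \<noteq> 0"
    using poly_tmin_poly_1_nonzero[OF inj D] by (simp add: poly_altdef assms(12,13))
  moreover have "Xbar = tscale (1 / (\<Sum>i\<le>d. \<theta> i)) (\<Sum>i\<le>d. tscale (\<theta> i) (X (n + i)))"
    using nz by (simp add: fun_eq_iff tscale_def sum_fun_apply sum)
  ultimately show ?thesis
    using tinvertible_ident_minus[OF inj] by blast
qed

end
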